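(* Let $G$ be a group with neutral element $e$ and $\mu$ a fuzzy subgroup of $G$. Then $\mu$ is normal if and only if $\widetilde{\sigma}(\mu)$ is normal, i.e. if and only if $\widetilde{\sigma}(\mu)(\alpha)$ is a normal subgroup of $G$ for every $\alpha\in(0,1]$.
   Context: A fuzzy subgroup of $G$ is a map $\mu:G\to[0,1]$, not constantly $0$, with $\mu(xy^{-1})\geq\min(\mu(x),\mu(y))$ for all $x,y\in G$; it is normal if $\mu(xy)=\mu(yx)$ for all $x,y\in G$. $\mu^1$ denotes the map with $\mu^1(e)=1$ and $\mu^1(x)=\mu(x)$ for $x\neq e$ (it is again a fuzzy subgroup). The gradual subgroup $\widetilde{\sigma}(\mu)$ is defined by $\widetilde{\sigma}(\mu)(\alpha)=\{x\in G\mid \mu^1(x)>\alpha\}$ for $\alpha\in(0,1)$ and $\widetilde{\sigma}(\mu)(1)=\{x\in G\mid \mu^1(x)=1\}$. *)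

theory Defs
  imports Complex_Main "HOL-Algebra.Coset"
begin

text \<open>
  Fuzzy subsets of a group \<open>G\<close> are functions \<open>'a \<Rightarrow> real\<close> of which only the values on
  \<open>carrier G\<close> matter.
\<close>

definition fuzzy_subgroup :: "('a, 'b) monoid_scheme \<Rightarrow> ('a \<Rightarrow> real) \<Rightarrow> bool" where
  "fuzzy_subgroup G \<mu> \<longleftrightarrow>
     \<mu> \<in> carrier G \<rightarrow> {0..1} \<and>
     (\<exists>x\<in>carrier G. \<mu> x \<noteq> 0) \<and>
     (\<forall>x\<in>carrier G. \<forall>y\<in>carrier G. \<mu> (x \<otimes>\<^bsub>G\<^esub> inv\<^bsub>G\<^esub> y) \<ge> min (\<mu> x) (\<mu> y))"

definition fuzzy_normal :: "('a, 'b) monoid_scheme \<Rightarrow> ('a \<Rightarrow> real) \<Rightarrow> bool" where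
  "fuzzy_normal G \<mu> \<longleftrightarrow>
     (\<forall>x\<in>carrier G. \<forall>y\<in>carrier G. \<mu> (x \<otimes>\<^bsub>G\<^esub> y) = \<mu> (y \<otimes>\<^bsub>G\<^esub> x))"

text \<open>The map written \<open>\<mu>\<^sup>1\<close> in the literature.\<close>

definition fuzzy_unit :: "('a, 'b) monoid_scheme \<Rightarrow> ('a \<Rightarrow> real) \<Rightarrow> 'a \<Rightarrow> real" where
  "fuzzy_unit G \<mu> = \<mu>(\<one>\<^bsub>G\<^esub> := 1)"

text \<open>
  A gradual subset of \<open>G\<close> is a family of subsets of \<open>carrier G\<close> indexed by \<open>(0, 1]\<close>; it is
  represented by a function on \<open>real\<close> whose values outside \<open>(0, 1]\<close> are irrelevant.
\<close>

definition sigma_tilde :: "('a, 'b) monoid_scheme \<Rightarrow> ('a \<Rightarrow> real) \<Rightarrow> real \<Rightarrow> 'a set" where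
  "sigma_tilde G \<mu> \<alpha> =
     (if \<alpha> = 1 then {x \<in> carrier G. fuzzy_unit G \<mu> x = 1}
      else {x \<in> carrier G. fuzzy_unit G \<mu> x > \<alpha>})"

definition gradual_normal :: "('a, 'b) monoid_scheme \<Rightarrow> (real \<Rightarrow> 'a set) \<Rightarrow> bool" where
  "gradual_normal G \<sigma> \<longleftrightarrow> (\<forall>\<alpha>\<in>{0<..1}. \<sigma> \<alpha> \<lhd> G)"

end

theory Submission
  imports Defs
begin

text \<open>Normality of \<mu> means invariance under conjugation, and a real-valued function is
  invariant exactly when its superlevel sets are. The sets
  \<open>sigma_tilde G \<mu> \<alpha>\<close> are superlevel sets of
  \<open>fuzzy_unit G \<mu>\<close>, so two bridges are needed: changing the value at the neutral
  element preserves fuzzy subgroups (\<open>fuzzy_subgroup_fuzzy_unit\<close>), whence the levels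
  are subgroups (\<open>subgroup_sigma_tilde\<close>), and it does not affect normality
  (\<open>fuzzy_normal_fuzzy_unit_iff\<close>). Conversely, if the values at xy and yx differed, a
  level strictly between them would contain just one of these two conjugate elements.\<close>

lemma fuzzy_subgroup_le_one:
  assumes "group G" and "fuzzy_subgroup G \<mu>" and x: "x \<in> carrier G"
  shows "\<mu> x \<le> \<mu> \<one>\<^bsub>G\<^esub>"
proof -
  interpret group G by fact
  have "min (\<mu> x) (\<mu> x) \<le> \<mu> (x \<otimes>\<^bsub>G\<^esub> inv\<^bsub>G\<^esub> x)"
    using assms by (simp only: fuzzy_subgroup_def)
  then show ?thesis using x by simp
qed

text \<open>Raising the value at the neutral element can only endanger the inequality when an
  argument on its left side is neutral, so the cases are split accordingly.\<close>

lemma fuzzy_subgroup_fuzzy_unit: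
  assumes "group G" and fuzzy: "fuzzy_subgroup G \<mu>"
  shows "fuzzy_subgroup G (fuzzy_unit G \<mu>)"
proof -
  interpret group G by fact
  have mem: "\<mu> x \<in> {0..1}" if "x \<in> carrier G" for x
    using fuzzy that by (auto simp: fuzzy_subgroup_def)
  have diff: "min (\<mu> x) (\<mu> y) \<le> \<mu> (x \<otimes>\<^bsub>G\<^esub> inv\<^bsub>G\<^esub> y)"
    if "x \<in> carrier G" "y \<in> carrier G" for x y
    using fuzzy that by (simp only: fuzzy_subgroup_def)
  have "min (fuzzy_unit G \<mu> x) (fuzzy_unit G \<mu> y) \<le> fuzzy_unit G \<mu> (x \<otimes>\<^bsub>G\<^esub> inv\<^bsub>G\<^esub> y)"
    if x: "x \<in> carrier G" and y: "y \<in> carrier G" for x y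
  proof (cases "x \<otimes>\<^bsub>G\<^esub> inv\<^bsub>G\<^esub> y = \<one>\<^bsub>G\<^esub>")
    case True
    then show ?thesis using mem[OF x] by (auto simp: fuzzy_unit_def)
  next
    case False
    consider "y = \<one>\<^bsub>G\<^esub>" | "x = \<one>\<^bsub>G\<^esub>" "y \<noteq> \<one>\<^bsub>G\<^esub>" | "x \<noteq> \<one>\<^bsub>G\<^esub>" "y \<noteq> \<one>\<^bsub>G\<^esub>"
      by blast
    then show ?thesis
    proof cases
      case 1
      then show ?thesis using x by simp
    next
      \<comment> \<open>The left side is now \<mu> y. It equals the minimum of \<mu> at the neutral
        element and at y, because \<mu> is largest at the neutral element; so the inequality for
        \<mu> itself suffices.\<close>
      case 2
      then show ?thesis
        using False y diff[OF x y] fuzzy_subgroup_le_one[OF assms y]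
        by (simp add: fuzzy_unit_def)
    next
      case 3
      then show ?thesis using False diff[OF x y] by (simp add: fuzzy_unit_def)
    qed
  qed
  moreover have "fuzzy_unit G \<mu> \<in> carrier G \<rightarrow> {0..1}"
    using mem by (auto simp: fuzzy_unit_def)
  moreover have "\<exists>x\<in>carrier G. fuzzy_unit G \<mu> x \<noteq> 0"
    by (intro bexI[of _ "\<one>\<^bsub>G\<^esub>"]) (simp_all add: fuzzy_unit_def)
  ultimately show ?thesis by (simp add: fuzzy_subgroup_def)
qed

text \<open>In a group xy is neutral iff yx is, so the modification touches both sides of the
  normality equation or neither.\<close>

lemma fuzzy_normal_fuzzy_unit_iff:
  assumes "group G"
  shows "fuzzy_normal G (fuzzy_unit G \<mu>) \<longleftrightarrow> fuzzy_normal G \<mu>"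
proof -
  interpret group G by fact
  have comm: "x \<otimes>\<^bsub>G\<^esub> y = \<one>\<^bsub>G\<^esub> \<longleftrightarrow> y \<otimes>\<^bsub>G\<^esub> x = \<one>\<^bsub>G\<^esub>"
    if "x \<in> carrier G" "y \<in> carrier G" for x y
    using that inv_comm by blast
  have "fuzzy_unit G \<mu> (x \<otimes>\<^bsub>G\<^esub> y) = fuzzy_unit G \<mu> (y \<otimes>\<^bsub>G\<^esub> x) \<longleftrightarrow> \<mu> (x \<otimes>\<^bsub>G\<^esub> y) = \<mu> (y \<otimes>\<^bsub>G\<^esub> x)"
    if "x \<in> carrier G" "y \<in> carrier G" for x y
    using comm[OF that] by (cases "x \<otimes>\<^bsub>G\<^esub> y = \<one>\<^bsub>G\<^esub>") (auto simp: fuzzy_unit_def)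
  then show ?thesis by (simp add: fuzzy_normal_def)
qed

text \<open>Closure under x, y to x times the inverse of y comes from the fuzzy inequality; inverses
  follow by taking x neutral, and products by replacing y with its inverse.\<close>

lemma subgroup_sigma_tilde:
  assumes "group G" and "fuzzy_subgroup G \<mu>" and \<alpha>: "\<alpha> \<in> {0<..1}"
  shows "subgroup (sigma_tilde G \<mu> \<alpha>) G"
proof -
  interpret group G by fact
  let ?\<nu> = "fuzzy_unit G \<mu>"
  have fuzzy: "fuzzy_subgroup G ?\<nu>"
    using assms(1,2) by (rule fuzzy_subgroup_fuzzy_unit)
  have le1: "?\<nu> x \<le> 1" if "x \<in> carrier G" for x
    using fuzzy that by (auto simp: fuzzy_subgroup_def)
  have diff: "min (?\<nu> x) (?\<nu> y) \<le> ?\<nu> (x \<otimes>\<^bsub>G\<^esub> inv\<^bsub>G\<^esub> y)"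
    if "x \<in> carrier G" "y \<in> carrier G" for x y
    using fuzzy that by (simp only: fuzzy_subgroup_def)
  have one: "?\<nu> \<one>\<^bsub>G\<^esub> = 1" by (simp add: fuzzy_unit_def)
  have sub: "sigma_tilde G \<mu> \<alpha> \<subseteq> carrier G"
    by (auto simp: sigma_tilde_def)
  have mem_one: "\<one>\<^bsub>G\<^esub> \<in> sigma_tilde G \<mu> \<alpha>"
    using one \<alpha> by (simp add: sigma_tilde_def)
  have mem_diff: "x \<otimes>\<^bsub>G\<^esub> inv\<^bsub>G\<^esub> y \<in> sigma_tilde G \<mu> \<alpha>"
    if "x \<in> sigma_tilde G \<mu> \<alpha>" "y \<in> sigma_tilde G \<mu> \<alpha>" for x y
  proof -
    have "x \<in> carrier G" "y \<in> carrier G" using that sub by auto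
    \<comment> \<open>At level 1 the inequality gives only a value of at least 1; the upper bound
      \<open>le1\<close> turns this into equality.\<close>
    with that diff[of x y] le1[of "x \<otimes>\<^bsub>G\<^esub> inv\<^bsub>G\<^esub> y"] show ?thesis
      by (auto simp: sigma_tilde_def split: if_splits)
  qed
  have mem_inv: "inv\<^bsub>G\<^esub> y \<in> sigma_tilde G \<mu> \<alpha>" if "y \<in> sigma_tilde G \<mu> \<alpha>" for y
    using mem_diff[OF mem_one that] that sub by auto
  show ?thesis
  proof (rule subgroupI)
    show "x \<otimes>\<^bsub>G\<^esub> y \<in> sigma_tilde G \<mu> \<alpha>"
      if "x \<in> sigma_tilde G \<mu> \<alpha>" "y \<in> sigma_tilde G \<mu> \<alpha>" for x y
      using mem_diff[OF that(1) mem_inv[OF that(2)]] that sub by auto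
  qed (use sub mem_one mem_inv in auto)
qed

lemma fuzzy_normal_imp_gradual_normal:
  assumes "group G" and "fuzzy_subgroup G \<mu>" and normal: "fuzzy_normal G \<mu>"
  shows "gradual_normal G (sigma_tilde G \<mu>)"
proof -
  interpret group G by fact
  have "fuzzy_normal G (fuzzy_unit G \<mu>)"
    using normal fuzzy_normal_fuzzy_unit_iff[OF assms(1)] by simp
  then have swap: "fuzzy_unit G \<mu> (x \<otimes>\<^bsub>G\<^esub> y) = fuzzy_unit G \<mu> (y \<otimes>\<^bsub>G\<^esub> x)"
    if "x \<in> carrier G" "y \<in> carrier G" for x y
    using that by (simp add: fuzzy_normal_def)
  have conj: "fuzzy_unit G \<mu> (x \<otimes>\<^bsub>G\<^esub> h \<otimes>\<^bsub>G\<^esub> inv\<^bsub>G\<^esub> x) = fuzzy_unit G \<mu> h"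
    if "x \<in> carrier G" "h \<in> carrier G" for x h
    \<comment> \<open>Moving the inverse of x to the front cancels the leading x and leaves
      h.\<close>
    using swap[of "x \<otimes>\<^bsub>G\<^esub> h" "inv\<^bsub>G\<^esub> x"] that by (simp add: m_assoc[symmetric])
  have "sigma_tilde G \<mu> \<alpha> \<lhd> G" if "\<alpha> \<in> {0<..1}" for \<alpha>
    unfolding normal_inv_iff
    using subgroup_sigma_tilde[OF assms(1,2) that] conj
    by (auto simp: sigma_tilde_def)
  then show ?thesis by (simp add: gradual_normal_def)
qed

lemma gradual_normal_imp_fuzzy_normal:
  assumes "group G" and "fuzzy_subgroup G \<mu>"
    and normal: "gradual_normal G (sigma_tilde G \<mu>)"
  shows "fuzzy_normal G \<mu>"
proof -
  interpret group G by fact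
  let ?\<nu> = "fuzzy_unit G \<mu>"
  have mem: "?\<nu> x \<in> {0..1}" if "x \<in> carrier G" for x
    using fuzzy_subgroup_fuzzy_unit[OF assms(1,2)] that
    by (auto simp: fuzzy_subgroup_def)
  have le: "?\<nu> (y \<otimes>\<^bsub>G\<^esub> x) \<le> ?\<nu> (x \<otimes>\<^bsub>G\<^esub> y)"
    if x: "x \<in> carrier G" and y: "y \<in> carrier G" for x y
  proof (rule ccontr)
    assume "\<not> ?thesis"
    then obtain \<alpha> where \<alpha>: "?\<nu> (x \<otimes>\<^bsub>G\<^esub> y) < \<alpha>" "\<alpha> < ?\<nu> (y \<otimes>\<^bsub>G\<^esub> x)"
      using dense not_le by metis
    \<comment> \<open>Lying strictly between two values in [0,1] forces \<alpha> into the open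
      interval, where \<open>sigma_tilde\<close> is the strict superlevel set.\<close>
    have range: "0 < \<alpha>" "\<alpha> < 1"
      using \<alpha> mem[of "x \<otimes>\<^bsub>G\<^esub> y"] mem[of "y \<otimes>\<^bsub>G\<^esub> x"] x y by auto
    then have level: "sigma_tilde G \<mu> \<alpha> = {z \<in> carrier G. \<alpha> < ?\<nu> z}"
      by (simp add: sigma_tilde_def)
    have "sigma_tilde G \<mu> \<alpha> \<lhd> G"
      using normal range by (simp add: gradual_normal_def)
    moreover have "y \<otimes>\<^bsub>G\<^esub> x \<in> sigma_tilde G \<mu> \<alpha>"
      using \<alpha> x y by (simp add: level)
    \<comment> \<open>Conjugating yx by x yields xy, which would therefore have a value above
      \<alpha>.\<close>
    ultimately have "x \<otimes>\<^bsub>G\<^esub> (y \<otimes>\<^bsub>G\<^esub> x) \<otimes>\<^bsub>G\<^esub> inv\<^bsub>G\<^esub> x \<in> sigma_tilde G \<mu> \<alpha>"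
      using x by (simp only: normal_inv_iff)
    moreover have "x \<otimes>\<^bsub>G\<^esub> (y \<otimes>\<^bsub>G\<^esub> x) \<otimes>\<^bsub>G\<^esub> inv\<^bsub>G\<^esub> x = x \<otimes>\<^bsub>G\<^esub> y"
      using x y by (simp add: m_assoc)
    ultimately show False using \<alpha> by (simp add: level)
  qed
  \<comment> \<open>The inequality holds for every ordered pair, so exchanging x and y gives
    equality.\<close>
  then have "fuzzy_normal G ?\<nu>"
    by (simp add: fuzzy_normal_def order.antisym)
  then show ?thesis
    using fuzzy_normal_fuzzy_unit_iff[OF assms(1)] by simp
qed

theorem mainTheorem2:
  fixes G :: "('a, 'b) monoid_scheme" and \<mu> :: "'a \<Rightarrow> real"
  assumes "group G" and "fuzzy_subgroup G \<mu>"
  shows "fuzzy_normal G \<mu> \<longleftrightarrow> gradual_normal G (sigma_tilde G \<mu>)"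
  using fuzzy_normal_imp_gradual_normal[OF assms] gradual_normal_imp_fuzzy_normal[OF assms]
  by blast

end
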